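(* Let $h$ be a regularizer function on the unit simplex $\Delta_d\subset\mathbb{R}^d$ that is $K$-strongly convex with respect to the $\ell^1$ norm $\|\cdot\|_1$ (where $K>0$), and let $\eta>0$. Then, for every sequence of payoff vectors $(u_n)_{n\geq1}$ in $[-1,1]^d$, the strategy given by $x_1=Q_h(0)$ and $$x_{n+1}=Q_h\left(\frac{\eta}{n}\sum_{k=1}^nu_k\right),\quad n\geq1,$$ guarantees, for every $n\geq1$, $$\max_{a\in\mathcal{A}}\sum_{k=1}^n\langle u_k|e_a-x_k\rangle\leq\frac{h_{\max}-h_{\min}}{\eta}n+\frac{\eta\log n}{2K}+\frac{\eta}{K}.$$ In particular, this strategy leads to $\varepsilon$-regret and to $\varepsilon$-realized-regret with $\varepsilon=(h_{\max}-h_{\min})/\eta$.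
   Context: $\mathcal{A}=\{1,\dots,d\}$ is a finite set of pure actions, $\Delta_d=\{x\in\mathbb{R}^d_+:\sum_ix_i=1\}$ is identified with the set of probability distributions on $\mathcal{A}$, and $e_a$ is the $a$-th canonical basis vector. $V=\mathbb{R}^d$ carries the norm $\|\cdot\|_1$, so the dual norm is $\|\cdot\|_\infty$; $\langle u|x\rangle=\sum_iu_ix_i$. A convex function $h:\mathbb{R}^d\to\mathbb{R}\cup\{+\infty\}$ is a regularizer function on $\Delta_d$ if its effective domain $\{x:h(x)<\infty\}$ equals $\Delta_d$ and $h|_{\Delta_d}$ is strictly convex and continuous. It is $K$-strongly convex w.r.t. $\|\cdot\|$ if $h(\lambda w_1+(1-\lambda)w_2)\leq\lambda h(w_1)+(1-\lambda)h(w_2)-\frac12K\lambda(1-\lambda)\|w_2-w_1\|^2$ for all $w_1,w_2\in\mathbb{R}^d$, $\lambda\in[0,1]$. The choice map is $Q_h(y)=\arg\max_{x\in\Delta_d}\{\langle y|x\rangle-h(x)\}$ (unique maximizer). $h_{\max},h_{\min}$ are the maximum and minimum of $h$ over $\Delta_d$. A strategy is a rule determining $x_{n+1}\in\Delta_d$ from $u_1,\dots,u_n$. It leads to $\varepsilon$-regret ($\varepsilon\geq0$) if, for every sequence $(u_n)_{n\geq1}$ with $\|u_n\|_\infty\leq1$, $\limsup_{n\to\infty}\frac1n\max_{x\in\Delta_d}\sum_{k=1}^n\langle u_k|x-x_k\rangle\leq\varepsilon$. Suppose that at each stage $n$ the agent draws a pure action $a_n\in\mathcal{A}$ at random, with distribution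 $x_n$ conditionally on the past. The strategy leads to $\varepsilon$-realized-regret if, for every sequence $(u_n)_{n\geq1}$ in $\mathbb{R}^d$ with $\|u_n\|_\infty\leq1$, $\limsup_{n\to\infty}\frac1n\max_{a\in\mathcal{A}}\sum_{k=1}^n(u_{k,a}-u_{k,a_k})\leq\varepsilon$ almost surely. *)

theory Defs
  imports "HOL-Probability.Probability"
begin

text \<open>
  The action set is a type 'd of class finite; $\mathbb{R}^d$ is the type of vectors indexed by 'd,
  and the action a corresponds to the basis vector \<open>axis a 1\<close>.
\<close>

definition prob_simplex :: "(real ^ 'd) set" where
  "prob_simplex = {x. (\<forall>i. 0 \<le> x $ i) \<and> (\<Sum>i\<in>UNIV. x $ i) = 1}"

definition l1norm :: "real ^ 'd \<Rightarrow> real" where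
  "l1norm x = (\<Sum>i\<in>UNIV. \<bar>x $ i\<bar>)"

text \<open>
  In the two convexity notions for extended-valued functions below, the library convention
  \<open>0 * \<infinity> = 0\<close> makes the inequalities trivially true for \<open>l = 0\<close> and \<open>l = 1\<close>.
\<close>

definition convex_ereal :: "('a::real_vector \<Rightarrow> ereal) \<Rightarrow> bool" where
  "convex_ereal h \<longleftrightarrow>
     (\<forall>w1 w2. \<forall>l\<in>{0..1}.
        h (l *\<^sub>R w1 + (1 - l) *\<^sub>R w2) \<le> ereal l * h w1 + ereal (1 - l) * h w2)"

definition strongly_convex :: "('a::real_vector \<Rightarrow> real) \<Rightarrow> real \<Rightarrow> ('a \<Rightarrow> ereal) \<Rightarrow> bool" where
  "strongly_convex nrm K h \<longleftrightarrow>
     (\<forall>w1 w2. \<forall>l\<in>{0..1}.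
        h (l *\<^sub>R w1 + (1 - l) *\<^sub>R w2)
          \<le> ereal l * h w1 + ereal (1 - l) * h w2
             - ereal (1 / 2 * K * l * (1 - l) * (nrm (w2 - w1))\<^sup>2))"

definition strictly_convex_on :: "'a::real_vector set \<Rightarrow> ('a \<Rightarrow> ereal) \<Rightarrow> bool" where
  "strictly_convex_on C h \<longleftrightarrow>
     (\<forall>w1\<in>C. \<forall>w2\<in>C. w1 \<noteq> w2 \<longrightarrow>
        (\<forall>l\<in>{0<..<1}.
          h (l *\<^sub>R w1 + (1 - l) *\<^sub>R w2) < ereal l * h w1 + ereal (1 - l) * h w2))"

definition regularizer :: "(real ^ 'd \<Rightarrow> ereal) \<Rightarrow> bool" where
  "regularizer h \<longleftrightarrow>
     (\<forall>x. h x \<noteq> -\<infinity>) \<and> convex_ereal h \<and> {x. h x < \<infinity>} = prob_simplex \<and>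
     strictly_convex_on prob_simplex h \<and> continuous_on prob_simplex h"

definition choice_map :: "(real ^ 'd \<Rightarrow> ereal) \<Rightarrow> real ^ 'd \<Rightarrow> real ^ 'd" where
  "choice_map h y = arg_max_on (\<lambda>x. ereal (y \<bullet> x) - h x) prob_simplex"

definition h_max :: "(real ^ 'd \<Rightarrow> ereal) \<Rightarrow> real" where
  "h_max h = (GREATEST r. r \<in> (\<lambda>x. real_of_ereal (h x)) ` prob_simplex)"

definition h_min :: "(real ^ 'd \<Rightarrow> ereal) \<Rightarrow> real" where
  "h_min h = (LEAST r. r \<in> (\<lambda>x. real_of_ereal (h x)) ` prob_simplex)"

text \<open>
  A strategy maps the list \<open>[u\<^sub>1, \<dots>, u\<^sub>n]\<close> of past payoff vectors to \<open>x\<^sub>n\<^sub>+\<^sub>1\<close>.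
  Stages are numbered from 1; the value of a sequence at index 0 is never used.
\<close>

type_synonym 'd strategy = "(real ^ 'd) list \<Rightarrow> real ^ 'd"

definition is_strategy :: "'d::finite strategy \<Rightarrow> bool" where
  "is_strategy \<sigma> \<longleftrightarrow> (\<forall>us. \<sigma> us \<in> prob_simplex)"

definition play :: "'d::finite strategy \<Rightarrow> (nat \<Rightarrow> real ^ 'd) \<Rightarrow> nat \<Rightarrow> real ^ 'd" where
  "play \<sigma> u n = \<sigma> (map u [1..<n])"

text \<open>The function \<open>infnorm\<close> is the norm dual to \<open>l1norm\<close>.\<close>

definition leads_to_regret :: "'d::finite strategy \<Rightarrow> real \<Rightarrow> bool" where
  "leads_to_regret \<sigma> \<epsilon> \<longleftrightarrow>
     0 \<le> \<epsilon> \<and>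
     (\<forall>u. (\<forall>n\<ge>1. infnorm (u n) \<le> 1) \<longrightarrow>
        limsup (\<lambda>n. ereal (1 / real n *
          (GREATEST r. r \<in> (\<lambda>x. \<Sum>k=1..n. u k \<bullet> (x - play \<sigma> u k)) ` prob_simplex)))
        \<le> ereal \<epsilon>)"

text \<open>
  The random actions \<open>a n\<close> live on the probability space M, and \<open>F n\<close> is the past of stage n: it
  contains the actions drawn at the stages before n, and possibly other events.
\<close>

definition draws_actions ::
    "'w measure \<Rightarrow> (nat \<Rightarrow> 'w measure) \<Rightarrow> (nat \<Rightarrow> real ^ 'd) \<Rightarrow> (nat \<Rightarrow> 'w \<Rightarrow> 'd) \<Rightarrow> bool" where
  "draws_actions M F x a \<longleftrightarrow>
     filtration (space M) F \<and> (\<forall>n. subalgebra M (F n)) \<and>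
     (\<forall>n\<ge>1. a n \<in> measurable (F (Suc n)) (count_space UNIV)) \<and>
     (\<forall>n\<ge>1. \<forall>i. AE w in M. real_cond_exp M (F n) (\<lambda>w. indicator {i} (a n w)) w = x n $ i)"

definition leads_to_realized_regret :: "'w measure \<Rightarrow> 'd::finite strategy \<Rightarrow> real \<Rightarrow> bool" where
  "leads_to_realized_regret M \<sigma> \<epsilon> \<longleftrightarrow>
     0 \<le> \<epsilon> \<and>
     (\<forall>u F a. (\<forall>n\<ge>1. infnorm (u n) \<le> 1) \<longrightarrow> draws_actions M F (play \<sigma> u) a \<longrightarrow>
        (AE w in M.
          limsup (\<lambda>n. ereal (1 / real n * (MAX i. \<Sum>k=1..n. (u k $ i - u k $ a k w))))
          \<le> ereal \<epsilon>))"

definition averaging_strategy :: "(real ^ 'd \<Rightarrow> ereal) \<Rightarrow> real \<Rightarrow> 'd::finite strategy" where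
  "averaging_strategy h \<eta> us =
     (if us = [] then choice_map h 0
      else choice_map h ((\<eta> / real (length us)) *\<^sub>R sum_list us))"

end

theory Submission
  imports Defs "HOL-Library.Discrete_Functions"
begin

text \<open>
  The strategy is follow-the-regularized-leader with the decreasing parameters \<open>e n = \<eta> / n\<close>.
  Strong convexity of \<open>h\<close> makes \<open>h\<close> grow quadratically around the maximizer \<open>choice_map h y\<close>,
  so that its conjugate is smooth with constant \<open>1 / K\<close>. Hence the potential
  \<open>max\<^sub>z (u\<^sub>1 + \<dots> + u\<^sub>n) \<bullet> z - (h z - h_min h) / e n\<close> increases at stage \<open>n + 1\<close> by at most the
  payoff of \<open>x\<^sub>n\<^sub>+\<^sub>1\<close> plus \<open>e n / (2 * K)\<close>; subtracting \<open>h_min h\<close> makes it monotone in the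
  parameter, so lowering \<open>e\<close> costs nothing. The errors sum to a harmonic sum.

  For the realized regret, the differences between expected and drawn payoffs are bounded
  martingale increments. They are orthogonal, so their sums have second moment of order \<open>n\<close>, and
  their averages tend to 0 almost surely: first along the squares, by summability of the second
  moments, and then along all \<open>n\<close>, by boundedness.
\<close>

subsection \<open>Regularizers and the choice map\<close>

lemma axis_in_prob_simplex: "axis i 1 \<in> prob_simplex"
  by (auto simp: prob_simplex_def axis_def)

lemma prob_simplex_nonempty: "prob_simplex \<noteq> {}"
  using axis_in_prob_simplex by blast

lemma compact_prob_simplex: "compact (prob_simplex :: (real ^ 'd::finite) set)"
proof -
  have le1: "x $ i \<le> 1" if "x \<in> prob_simplex" for x :: "real ^ 'd" and i
    using that member_le_sum[of i UNIV "\<lambda>i. x $ i"] by (auto simp: prob_simplex_def)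
  have "prob_simplex \<subseteq> cbox (0 :: real ^ 'd) 1"
    using le1 by (auto simp: mem_box_cart prob_simplex_def)
  then have "bounded (prob_simplex :: (real ^ 'd) set)"
    using bounded_cbox bounded_subset by blast
  moreover have "closed (prob_simplex :: (real ^ 'd) set)"
    unfolding prob_simplex_def
    by (intro closed_Collect_conj closed_Collect_all closed_Collect_le closed_Collect_eq
        continuous_intros)
  ultimately show ?thesis
    by (simp add: compact_eq_bounded_closed)
qed

lemma convex_prob_simplex: "convex prob_simplex"
  by (auto simp: prob_simplex_def convex_def sum.distrib sum_distrib_left[symmetric])

lemma regularizer_finite:
  assumes "regularizer h" "x \<in> prob_simplex"
  shows "h x = ereal (real_of_ereal (h x))"
proof -
  have "h x < \<infinity>" "h x \<noteq> -\<infinity>"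
    using assms by (auto simp: regularizer_def)
  then show ?thesis
    by (cases "h x") auto
qed

lemma continuous_on_regularizer:
  assumes "regularizer h"
  shows "continuous_on prob_simplex (\<lambda>x. real_of_ereal (h x))"
proof -
  have "\<bar>h x\<bar> \<noteq> \<infinity>" if "x \<in> prob_simplex" for x
    using assms that by (cases "h x") (auto simp: regularizer_def)
  then show ?thesis
    using continuous_on_iff_real[of prob_simplex h] assms
    by (simp add: regularizer_def o_def)
qed

text \<open>\<open>GREATEST\<close> is informative only when the supremum is attained, which
  compactness and continuity guarantee. This serves both \<open>h_max\<close> and the maximum in
  \<open>leads_to_regret\<close>.\<close>

lemma Greatest_image_compact:
  fixes f :: "'a::topological_space \<Rightarrow> real"
  assumes "compact S" "S \<noteq> {}" "continuous_on S f"
  shows "\<exists>x\<in>S. (GREATEST r. r \<in> f ` S) = f x"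
    and "x \<in> S \<Longrightarrow> f x \<le> (GREATEST r. r \<in> f ` S)"
proof -
  obtain z where z: "z \<in> S" "\<forall>y\<in>S. f y \<le> f z"
    using continuous_attains_sup[OF assms] by blast
  then have "(GREATEST r. r \<in> f ` S) = f z"
    by (intro Greatest_equality) auto
  with z show "\<exists>x\<in>S. (GREATEST r. r \<in> f ` S) = f x"
    and "x \<in> S \<Longrightarrow> f x \<le> (GREATEST r. r \<in> f ` S)" by auto
qed

lemma regularizer_le_h_max:
  fixes h :: "real ^ 'd::finite \<Rightarrow> ereal"
  assumes "regularizer h" "x \<in> prob_simplex"
  shows "real_of_ereal (h x) \<le> h_max h"
  unfolding h_max_def
  using Greatest_image_compact(2)[OF compact_prob_simplex prob_simplex_nonempty
      continuous_on_regularizer[OF assms(1)] assms(2)] .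

lemma h_min_le_regularizer:
  fixes h :: "real ^ 'd::finite \<Rightarrow> ereal"
  assumes "regularizer h" "x \<in> prob_simplex"
  shows "h_min h \<le> real_of_ereal (h x)"
proof -
  obtain z where z: "z \<in> prob_simplex"
      "\<forall>y\<in>prob_simplex. real_of_ereal (h z) \<le> real_of_ereal (h y)"
    using continuous_attains_inf[OF compact_prob_simplex prob_simplex_nonempty
      continuous_on_regularizer[OF assms(1)]] by blast
  then have "h_min h = real_of_ereal (h z)"
    unfolding h_min_def by (intro Least_equality) auto
  with z assms(2) show ?thesis by simp
qed

text \<open>\<open>choice_map\<close> is a Hilbert choice, so its properties follow once some
  maximizer exists. On the simplex the extended objective agrees with a continuous real function,
  which attains its maximum by compactness.\<close>

lemma choice_map_maximizes:
  fixes h :: "real ^ 'd::finite \<Rightarrow> ereal"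
  assumes h: "regularizer h"
  shows "choice_map h y \<in> prob_simplex"
    and "z \<in> prob_simplex \<Longrightarrow>
      y \<bullet> z - real_of_ereal (h z) \<le> y \<bullet> choice_map h y - real_of_ereal (h (choice_map h y))"
proof -
  let ?f = "\<lambda>x. ereal (y \<bullet> x) - h x"
  have f: "?f x = ereal (y \<bullet> x - real_of_ereal (h x))" if "x \<in> prob_simplex" for x
    by (subst regularizer_finite[OF h that]) simp
  have "continuous_on prob_simplex (\<lambda>x. y \<bullet> x - real_of_ereal (h x))"
    by (intro continuous_intros continuous_on_regularizer h)
  then obtain w where "w \<in> prob_simplex"
      "\<forall>z\<in>prob_simplex. y \<bullet> z - real_of_ereal (h z) \<le> y \<bullet> w - real_of_ereal (h w)"
    using continuous_attains_sup[OF compact_prob_simplex prob_simplex_nonempty] by blast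
  then have "is_arg_max ?f (\<lambda>x. x \<in> prob_simplex) w"
    unfolding is_arg_max_linorder using f by simp
  then have *: "is_arg_max ?f (\<lambda>x. x \<in> prob_simplex) (choice_map h y)"
    unfolding choice_map_def arg_max_on_def arg_max_def by (rule someI)
  then show "choice_map h y \<in> prob_simplex"
    by (simp add: is_arg_max_def)
  with * show "y \<bullet> z - real_of_ereal (h z)
      \<le> y \<bullet> choice_map h y - real_of_ereal (h (choice_map h y))" if "z \<in> prob_simplex"
    unfolding is_arg_max_linorder using that f by (metis ereal_less_eq(3))
qed

text \<open>Hoelder's inequality for the dual pair of the l1 norm and the sup norm.\<close>

lemma inner_le_l1norm:
  assumes "\<forall>i. \<bar>v $ i\<bar> \<le> 1"
  shows "v \<bullet> x \<le> l1norm x"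
  unfolding inner_vec_def l1norm_def
proof (rule sum_mono)
  fix i
  have "v $ i * x $ i \<le> \<bar>v $ i\<bar> * \<bar>x $ i\<bar>"
    by (metis abs_ge_self abs_mult)
  also have "\<dots> \<le> \<bar>x $ i\<bar>"
    using assms mult_right_mono[of "\<bar>v $ i\<bar>" 1 "\<bar>x $ i\<bar>"] by simp
  finally show "inner (v $ i) (x $ i) \<le> \<bar>x $ i\<bar>" by simp
qed

text \<open>First-order optimality at \<open>x = choice_map h y\<close>: compare \<open>x\<close> with
  \<open>l *\<^sub>R z + (1 - l) *\<^sub>R x\<close>, divide by \<open>l\<close> and let \<open>l\<close> tend to 0.\<close>

lemma choice_map_quadratic_growth:
  fixes h :: "real ^ 'd::finite \<Rightarrow> ereal" and y :: "real ^ 'd"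
  assumes h: "regularizer h" and sc: "strongly_convex l1norm K h" and z: "z \<in> prob_simplex"
  defines "x \<equiv> choice_map h y"
  shows "y \<bullet> z - real_of_ereal (h z) + K / 2 * (l1norm (z - x))\<^sup>2
      \<le> y \<bullet> x - real_of_ereal (h x)"
proof -
  let ?H = "\<lambda>x. real_of_ereal (h x)" and ?q = "(l1norm (z - x))\<^sup>2"
  have x: "x \<in> prob_simplex"
    unfolding x_def by (rule choice_map_maximizes[OF h])
  have l1: "l1norm (x - z) = l1norm (z - x)"
    by (simp add: l1norm_def abs_minus_commute)
  have ineq: "y \<bullet> z - ?H z + K / 2 * (1 - l) * ?q \<le> y \<bullet> x - ?H x" if l: "0 < l" "l < 1" for l
  proof -
    let ?w = "l *\<^sub>R z + (1 - l) *\<^sub>R x"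
    have w: "?w \<in> prob_simplex"
      using convexD_alt[OF convex_prob_simplex x z, of l] l by (simp add: add.commute)
    have "h ?w \<le> ereal l * h z + ereal (1 - l) * h x
        - ereal (1 / 2 * K * l * (1 - l) * (l1norm (x - z))\<^sup>2)"
      using sc l unfolding strongly_convex_def by auto
    \<comment> \<open>Passage from \<open>ereal\<close> to \<open>real\<close>: \<open>h\<close> is
      finite at \<open>?w\<close>, \<open>z\<close> and \<open>x\<close>, so the convexity
      inequality can be read among reals.\<close>
    moreover have "a \<le> l * b + (1 - l) * c - q"
      if "A \<le> ereal l * B + ereal (1 - l) * C - ereal q" "A = ereal a" "B = ereal b" "C = ereal c"
      for A B C a b c q
      using that by simp
    ultimately have "?H ?w \<le> l * ?H z + (1 - l) * ?H x - 1 / 2 * K * l * (1 - l) * ?q"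
      using regularizer_finite[OF h] w x z unfolding l1 by blast
    moreover have "y \<bullet> ?w - ?H ?w \<le> y \<bullet> x - ?H x"
      using choice_map_maximizes(2)[OF h w] by (simp add: x_def)
    ultimately have "l * (y \<bullet> z - ?H z + K / 2 * (1 - l) * ?q) \<le> l * (y \<bullet> x - ?H x)"
      by (simp add: inner_add_right algebra_simps)
    then show ?thesis using l by simp
  qed
  have "((\<lambda>l. y \<bullet> z - ?H z + K / 2 * (1 - l) * ?q) \<longlongrightarrow> y \<bullet> z - ?H z + K / 2 * (1 - 0) * ?q) (at_right 0)"
    by (intro tendsto_intros)
  moreover have "\<forall>\<^sub>F l in at_right 0. y \<bullet> z - ?H z + K / 2 * (1 - l) * ?q \<le> y \<bullet> x - ?H x"
    \<comment> \<open>The inequality holds on the whole interval from 0 to 1, hence the witness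
      1.\<close>
    using ineq by (auto simp: eventually_at_right_field intro!: exI[of _ 1])
  ultimately show ?thesis
    using tendsto_upperbound[of _ _ "at_right (0::real)"] by fastforce
qed

text \<open>By quadratic growth for \<open>e *\<^sub>R y\<close>, divided by \<open>e\<close>,
  moving from \<open>x\<close> to \<open>z\<close> loses at least \<open>K / (2 * e)\<close> times
  the squared distance, while \<open>v\<close> gains at most the distance. The last term bounds the
  net gain.\<close>

lemma choice_map_smooth:
  fixes h :: "real ^ 'd::finite \<Rightarrow> ereal" and y :: "real ^ 'd"
  assumes h: "regularizer h" and sc: "strongly_convex l1norm K h" and K: "K > 0"
    and z: "z \<in> prob_simplex" and v: "\<forall>i. \<bar>v $ i\<bar> \<le> 1" and e: "e > 0"
  defines "x \<equiv> choice_map h (e *\<^sub>R y)"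
  shows "(y + v) \<bullet> z - real_of_ereal (h z) / e
      \<le> y \<bullet> x - real_of_ereal (h x) / e + v \<bullet> x + e / (2 * K)"
proof -
  let ?n = "l1norm (z - x)"
  have "e * (y \<bullet> z - real_of_ereal (h z) / e + K / (2 * e) * ?n\<^sup>2)
      \<le> e * (y \<bullet> x - real_of_ereal (h x) / e)"
    using choice_map_quadratic_growth[OF h sc z, of "e *\<^sub>R y"] e
    by (simp add: x_def algebra_simps)
  then have "y \<bullet> z - real_of_ereal (h z) / e + K / (2 * e) * ?n\<^sup>2 \<le> y \<bullet> x - real_of_ereal (h x) / e"
    using e by simp
  moreover have "v \<bullet> z - v \<bullet> x \<le> ?n"
    using inner_le_l1norm[OF v, of "z - x"] by (simp add: inner_diff_right)
  moreover have "?n \<le> K / (2 * e) * ?n\<^sup>2 + e / (2 * K)"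
  proof -
    \<comment> \<open>Completing the square: \<open>t - K / (2 * e) * t^2\<close> is largest at
      \<open>t = e / K\<close>, with value \<open>e / (2 * K)\<close>.\<close>
    have "0 \<le> (K * ?n - e)\<^sup>2 / (2 * K * e)"
      using K e by simp
    also have "\<dots> = K / (2 * e) * ?n\<^sup>2 + e / (2 * K) - ?n"
      using K e by (simp add: field_simps power2_eq_square)
    finally show ?thesis by simp
  qed
  ultimately show ?thesis by (simp add: inner_add_left)
qed

subsection \<open>Follow the regularized leader with decreasing parameters\<close>

text \<open>Induction for all comparison points \<open>z\<close> at once: the smoothness bound
  replaces \<open>z\<close> by \<open>x (Suc n)\<close>, the maximizer for the parameter
  \<open>e n\<close>, and the induction hypothesis is then applied at that point.\<close>

lemma ftrl_potential:
  fixes h :: "real ^ 'd::finite \<Rightarrow> ereal"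
  assumes h: "regularizer h" and sc: "strongly_convex l1norm K h" and K: "K > 0"
    and e: "\<And>n. e n > 0" "decseq e"
    and u: "\<And>n i. n \<ge> 1 \<Longrightarrow> \<bar>u n $ i\<bar> \<le> 1"
    and x: "\<And>n. x (Suc n) = choice_map h (e n *\<^sub>R (\<Sum>k=1..n. u k))"
    and z: "z \<in> prob_simplex"
  shows "(\<Sum>k=1..n. u k) \<bullet> z - (real_of_ereal (h z) - h_min h) / e n
      \<le> (\<Sum>k=1..n. u k \<bullet> x k) + (\<Sum>k<n. e k) / (2 * K)"
  using z
proof (induction n arbitrary: z)
  case 0
  then show ?case
    using h_min_le_regularizer[OF h] e(1)[of 0] by simp
next
  case (Suc n)
  let ?H = "\<lambda>x. real_of_ereal (h x)" and ?Y = "\<Sum>k=1..n. u k"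
  \<comment> \<open>The numerator is nonnegative, so lowering the parameter only enlarges the
    penalty that is subtracted.\<close>
  have "(?H z - h_min h) / e n \<le> (?H z - h_min h) / e (Suc n)"
    using h_min_le_regularizer[OF h Suc.prems] e(1)[of "Suc n"] decseqD[OF e(2), of n "Suc n"]
    by (intro divide_left_mono) (auto simp: e(1))
  moreover have "(?Y + u (Suc n)) \<bullet> z - ?H z / e n
      \<le> ?Y \<bullet> x (Suc n) - ?H (x (Suc n)) / e n + u (Suc n) \<bullet> x (Suc n) + e n / (2 * K)"
    unfolding x using choice_map_smooth[OF h sc K Suc.prems _ e(1)] u by simp
  moreover have "?Y \<bullet> x (Suc n) - (?H (x (Suc n)) - h_min h) / e n
      \<le> (\<Sum>k=1..n. u k \<bullet> x k) + (\<Sum>k<n. e k) / (2 * K)"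
    unfolding x by (intro Suc.IH[unfolded x] choice_map_maximizes(1)[OF h])
  ultimately show ?case
    by (simp add: diff_divide_distrib add_divide_distrib)
qed

text \<open>The potential bound becomes a regret bound once the penalty of \<open>z\<close> is
  replaced by its largest possible value.\<close>

lemma ftrl_regret:
  fixes h :: "real ^ 'd::finite \<Rightarrow> ereal"
  assumes h: "regularizer h" and sc: "strongly_convex l1norm K h" and K: "K > 0"
    and e: "\<And>n. e n > 0" "decseq e"
    and u: "\<And>n i. n \<ge> 1 \<Longrightarrow> \<bar>u n $ i\<bar> \<le> 1"
    and x: "\<And>n. x (Suc n) = choice_map h (e n *\<^sub>R (\<Sum>k=1..n. u k))"
    and z: "z \<in> prob_simplex"
  shows "(\<Sum>k=1..n. u k \<bullet> (z - x k)) \<le> (h_max h - h_min h) / e n + (\<Sum>k<n. e k) / (2 * K)"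
proof -
  have "(real_of_ereal (h z) - h_min h) / e n \<le> (h_max h - h_min h) / e n"
    using regularizer_le_h_max[OF h z] e(1)[of n] by (intro divide_right_mono) auto
  with ftrl_potential[OF assms, of n] show ?thesis
    by (simp add: inner_diff_right sum_subtractf inner_sum_left)
qed

text \<open>The differences \<open>harm (Suc m) - ln (Suc m)\<close> decrease in \<open>m\<close>
  and start at 1 for \<open>m = 0\<close>.\<close>

lemma harm_le_one_plus_ln:
  assumes "n \<ge> 1"
  shows "harm n \<le> 1 + ln (real n)"
  using decseqD[OF decseq_harm_diff_ln, of 0 "n - 1"] assms by (simp add: harm_expand)

text \<open>The play enters only through its recursion, so the bound applies both to an abstract
  sequence \<open>x\<close> and to \<open>play\<close> of the averaging strategy.\<close>

lemma averaging_regret: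
  fixes h :: "real ^ 'd::finite \<Rightarrow> ereal"
  assumes h: "regularizer h" and sc: "strongly_convex l1norm K h" and K: "K > 0" and \<eta>: "\<eta> > 0"
    and u: "\<And>n i. n \<ge> 1 \<Longrightarrow> \<bar>u n $ i\<bar> \<le> 1"
    and x1: "x 1 = choice_map h 0"
    and x: "\<And>n. n \<ge> 1 \<Longrightarrow> x (n + 1) = choice_map h ((\<eta> / real n) *\<^sub>R (\<Sum>k=1..n. u k))"
    and z: "z \<in> prob_simplex" and n: "n \<ge> 1"
  shows "(\<Sum>k=1..n. u k \<bullet> (z - x k))
      \<le> (h_max h - h_min h) / \<eta> * real n + \<eta> * ln (real n) / (2 * K) + \<eta> / K"
proof -
  \<comment> \<open>The value at 0 does not affect the play, since the empty sum vanishes; with \<open>\<eta>\<close> the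
    sequence stays positive and decreasing.\<close>
  define e where "e m = \<eta> / real (max 1 m)" for m
  have "x (Suc m) = choice_map h (e m *\<^sub>R (\<Sum>k=1..m. u k))" for m
    using x1 x[of m] by (cases "m = 0") (auto simp: e_def max_def)
  moreover have "e m > 0" for m
    using \<eta> by (simp add: e_def)
  moreover have "decseq e"
    unfolding e_def decseq_def using \<eta> by (auto intro!: divide_left_mono)
  ultimately have "(\<Sum>k=1..n. u k \<bullet> (z - x k)) \<le> (h_max h - h_min h) / e n + (\<Sum>k<n. e k) / (2 * K)"
    using h sc K u z by (intro ftrl_regret) auto
  \<comment> \<open>Since \<open>e 0\<close> and \<open>e 1\<close> both equal
    \<open>\<eta>\<close>, the sum is \<open>\<eta> * (1 + harm (n - 1))\<close>. The resulting
    constant 2, divided by \<open>2 * K\<close>, is the source of the term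
    \<open>\<eta> / K\<close>.\<close>
  moreover have "(\<Sum>k<n. e k) \<le> \<eta> * (2 + ln (real n))"
  proof -
    have e_Suc: "e (Suc m) = \<eta> * inverse (real (Suc m))" for m
      by (simp add: e_def divide_inverse)
    have "(\<Sum>k<Suc m. e k) = \<eta> * (1 + harm m)" for m
    proof (induction m)
      case 0
      then show ?case by (simp add: e_def harm_expand(1))
    next
      case (Suc m)
      have "(\<Sum>k<Suc (Suc m). e k) = \<eta> * (1 + harm m) + \<eta> * inverse (real (Suc m))"
        using Suc e_Suc by (simp only: sum.lessThan_Suc)
      then show ?case
        unfolding harm_Suc by (simp only: distrib_left add.assoc)
    qed
    moreover obtain m where m: "n = Suc m"
      using n by (cases n) auto
    moreover have "harm m \<le> 1 + ln (real n)"
    proof -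
      have "harm m \<le> (harm n :: real)"
        by (simp add: m harm_Suc)
      then show ?thesis
        using harm_le_one_plus_ln[OF n] by simp
    qed
    ultimately show ?thesis
      using \<eta> by simp
  qed
  ultimately have "(\<Sum>k=1..n. u k \<bullet> (z - x k))
      \<le> (h_max h - h_min h) / e n + \<eta> * (2 + ln (real n)) / (2 * K)"
    using K divide_right_mono[of "\<Sum>k<n. e k" "\<eta> * (2 + ln (real n))" "2 * K"] by linarith
  also have "\<dots> = (h_max h - h_min h) / \<eta> * real n + \<eta> * ln (real n) / (2 * K) + \<eta> / K"
    using K \<eta> n by (simp add: e_def field_simps max_def)
  finally show ?thesis .
qed

subsection \<open>A strong law for bounded martingale differences\<close>

text \<open>With \<open>m = floor_sqrt n\<close>, at most \<open>2 * m\<close> terms lie beyond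
  \<open>m^2\<close>. They change the sum by at most \<open>2 * m * c\<close>, and division by
  \<open>n\<close>, which is at least \<open>m^2\<close>, leaves \<open>2 * c / m\<close>.\<close>

lemma averages_tendsto_0_from_squares:
  fixes d :: "nat \<Rightarrow> real"
  assumes bound: "\<And>k. k \<ge> 1 \<Longrightarrow> \<bar>d k\<bar> \<le> c"
    and lim: "(\<lambda>m. (\<Sum>k=1..m\<^sup>2. d k) / real (m\<^sup>2)) \<longlonglongrightarrow> 0"
  shows "(\<lambda>n. (\<Sum>k=1..n. d k) / real n) \<longlonglongrightarrow> 0"
proof -
  let ?S = "\<lambda>n. \<Sum>k=1..n. d k"
  let ?g = "\<lambda>m. \<bar>?S (m\<^sup>2) / real (m\<^sup>2)\<bar> + 2 * c / real m"
  have "\<bar>?S n / real n\<bar> \<le> ?g (floor_sqrt n)" if n: "n \<ge> 1" for n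
  proof -
    let ?m = "floor_sqrt n"
    have c: "c \<ge> 0"
      using bound[of 1] by (meson abs_ge_zero le_numeral_extra(4) order.trans)
    have m: "?m\<^sup>2 \<le> n" "n \<le> ?m\<^sup>2 + 2 * ?m" "?m \<ge> 1"
      using floor_sqrt_power2_le[of n] Suc_floor_sqrt_power2_gt[of n]
        floor_sqrt_greater_zero_iff[of n] n
      by (simp_all add: power2_eq_square Suc_le_eq del: floor_sqrt_power2_le)
    have "?S n = ?S (?m\<^sup>2) + (\<Sum>k=?m\<^sup>2+1..n. d k)"
      using m(1) sum.ub_add_nat[of 1 "?m\<^sup>2" d "n - ?m\<^sup>2"] by simp
    moreover have "\<bar>\<Sum>k=?m\<^sup>2+1..n. d k\<bar> \<le> real (n - ?m\<^sup>2) * c"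
      using sum_norm_bound[of "{?m\<^sup>2+1..n}" d c] bound by simp
    moreover have "real (n - ?m\<^sup>2) \<le> real (2 * ?m)"
      using m(2) by (subst of_nat_le_iff) linarith
    then have "real (n - ?m\<^sup>2) * c \<le> 2 * real ?m * c"
      using c by (intro mult_right_mono) auto
    ultimately have "\<bar>?S n\<bar> \<le> \<bar>?S (?m\<^sup>2)\<bar> + 2 * real ?m * c"
      by linarith
    then have "\<bar>?S n\<bar> / real n \<le> (\<bar>?S (?m\<^sup>2)\<bar> + 2 * real ?m * c) / real (?m\<^sup>2)"
      using m c n by (intro frac_le) (auto simp del: of_nat_power)
    also have "\<dots> = ?g ?m"
      using m(3) by (simp add: field_simps power2_eq_square)
    finally show ?thesis by simp
  qed
  moreover have "(\<lambda>n. ?g (floor_sqrt n)) \<longlonglongrightarrow> 0"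
  proof (rule filterlim_compose[where g = ?g])
    have "?g \<longlonglongrightarrow> \<bar>0\<bar> + 0"
      by (intro tendsto_add tendsto_rabs lim lim_const_over_n)
    then show "?g \<longlonglongrightarrow> 0" by simp
    \<comment> \<open>\<open>m \<le> floor_sqrt n\<close> means \<open>m^2 \<le> n\<close>, so
      \<open>m^2\<close> is the threshold for \<open>m\<close>.\<close>
    show "filterlim floor_sqrt sequentially sequentially"
      unfolding filterlim_at_top eventually_sequentially le_floor_sqrt_iff by blast
  qed
  ultimately show ?thesis
    by (intro Lim_null_comparison[of "\<lambda>n. ?S n / real n"]) (auto simp: eventually_sequentially)
qed

text \<open>Sum and integral of nonnegative functions commute, so the series has finite expectation.
  Hence it converges almost everywhere and its terms vanish in the limit.\<close>

lemma (in prob_space) AE_tendsto_0_of_summable_expectation: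
  fixes f :: "nat \<Rightarrow> 'a \<Rightarrow> real"
  assumes int: "\<And>n. integrable M (f n)" and nonneg: "\<And>n w. f n w \<ge> 0"
    and sum: "summable (\<lambda>n. expectation (f n))"
  shows "AE w in M. (\<lambda>n. f n w) \<longlonglongrightarrow> 0"
proof -
  have [measurable]: "f n \<in> borel_measurable M" for n
    using int by blast
  have "(\<integral>\<^sup>+w. (\<Sum>n. ennreal (f n w)) \<partial>M) = (\<Sum>n. \<integral>\<^sup>+w. ennreal (f n w) \<partial>M)"
    by (rule nn_integral_suminf) auto
  also have "\<dots> = (\<Sum>n. ennreal (expectation (f n)))"
    using int nonneg by (simp add: nn_integral_eq_integral)
  also have "\<dots> \<noteq> \<infinity>"
    using sum nonneg by (simp add: suminf_ennreal2 integral_nonneg_AE)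
  finally have "AE w in M. (\<Sum>n. ennreal (f n w)) \<noteq> \<infinity>"
    by (intro nn_integral_PInf_AE) auto
  then show ?thesis
  proof eventually_elim
    case (elim w)
    then have "summable (\<lambda>n. f n w)"
      using nonneg by (intro summable_suminf_not_top) auto
    then show ?case
      by (rule summable_LIMSEQ_zero)
  qed
qed

context prob_space
begin

context
  fixes F :: "nat \<Rightarrow> 'a measure" and D :: "nat \<Rightarrow> 'a \<Rightarrow> real" and c :: real
  assumes filt: "filtration (space M) F"
    and sub: "\<And>n. subalgebra M (F n)"
    and adapted: "\<And>n. n \<ge> 1 \<Longrightarrow> D n \<in> borel_measurable (F (Suc n))"
    and bound: "\<And>n w. n \<ge> 1 \<Longrightarrow> \<bar>D n w\<bar> \<le> c"
    and centered: "\<And>n. n \<ge> 1 \<Longrightarrow> AE w in M. real_cond_exp M (F n) (D n) w = 0"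
begin

text \<open>\<open>F (Suc n)\<close> is the past of stage \<open>Suc n\<close>. Measurability of the
  sum for it allows the sum to be taken out of the conditional expectation of
  \<open>D (Suc n)\<close>.\<close>

lemma martingale_sum_measurable: "(\<lambda>w. \<Sum>k=1..n. D k w) \<in> borel_measurable (F (Suc n))"
proof (rule borel_measurable_sum)
  fix k assume k: "k \<in> {1..n}"
  then have "sets (F (Suc k)) \<subseteq> sets (F (Suc n))"
    using filtration.sets_F_mono[OF filt] by simp
  then show "D k \<in> borel_measurable (F (Suc n))"
    using adapted[of k] k filtration.space_F[OF filt]
    by (auto intro: measurable_mono[THEN subsetD])
qed

lemma martingale_sum_borel_measurable: "(\<lambda>w. \<Sum>k=1..n. D k w) \<in> borel_measurable M"
  using measurable_from_subalg[OF sub martingale_sum_measurable] .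

lemma martingale_sum_bound: "\<bar>\<Sum>k=1..n. D k w\<bar> \<le> real n * c"
  using sum_norm_bound[of "{1..n}" "\<lambda>k. D k w" c] bound by simp

text \<open>Expanding the square, the cross term has expectation 0, so each stage adds at most
  \<open>c\<^sup>2\<close>. Integrability is carried along in the induction because linearity of the
  expectation requires it.\<close>

lemma martingale_sum_second_moment:
  "integrable M (\<lambda>w. (\<Sum>k=1..n. D k w)\<^sup>2) \<and>
    expectation (\<lambda>w. (\<Sum>k=1..n. D k w)\<^sup>2) \<le> real n * c\<^sup>2"
proof (induction n)
  case 0
  then show ?case by simp
next
  case (Suc n)
  let ?S = "\<lambda>w. \<Sum>k=1..n. D k w" and ?D = "D (Suc n)"
  interpret finite_measure_subalgebra M "F (Suc n)"
    by unfold_locales (rule sub)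
  have [measurable]: "?D \<in> borel_measurable M" "?S \<in> borel_measurable M"
    using measurable_from_subalg[OF sub adapted[of "Suc n"]] martingale_sum_borel_measurable
    by auto
  have c: "c \<ge> 0"
    \<comment> \<open>The bound holds at every point, so an arbitrary one yields the sign of
      \<open>c\<close>.\<close>
    using bound[of 1 undefined] by linarith
  have "\<bar>?S w * ?D w\<bar> \<le> (real n * c) * c" for w
    unfolding abs_mult using martingale_sum_bound[where w=w and n=n] bound[of "Suc n" w] c
    by (intro mult_mono) auto
  then have int_SD: "integrable M (\<lambda>w. ?S w * ?D w)"
    by (intro integrable_const_bound[of _ "(real n * c) * c"]) (auto simp del: One_nat_def)
  have D2: "(?D w)\<^sup>2 \<le> c\<^sup>2" for w
    using bound[of "Suc n" w] by (intro abs_le_square_iff[THEN iffD1]) auto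
  then have int_D2: "integrable M (\<lambda>w. (?D w)\<^sup>2)"
    by (intro integrable_const_bound[of _ "c\<^sup>2"]) auto
  have "expectation (\<lambda>w. ?S w * ?D w) = expectation (\<lambda>w. ?S w * real_cond_exp M (F (Suc n)) ?D w)"
    using real_cond_exp_intg(2)[OF int_SD martingale_sum_measurable] by simp
  also have "\<dots> = expectation (\<lambda>w. 0)"
    using centered[of "Suc n"] by (intro integral_cong_AE) (auto simp del: One_nat_def)
  finally have cross: "expectation (\<lambda>w. ?S w * ?D w) = 0" by simp
  have "expectation (\<lambda>w. (?D w)\<^sup>2) \<le> c\<^sup>2"
    using integral_mono[OF int_D2 integrable_const D2] by (simp add: prob_space)
  then show ?case
    using Suc.IH int_SD int_D2 cross by (simp add: power2_sum algebra_simps)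
qed

lemma martingale_strong_law: "AE w in M. (\<lambda>n. (\<Sum>k=1..n. D k w) / real n) \<longlonglongrightarrow> 0"
proof -
  let ?S = "\<lambda>n w. \<Sum>k=1..n. D k w"
  let ?f = "\<lambda>m w. (?S (m\<^sup>2) w / real (m\<^sup>2))\<^sup>2"
  have int: "integrable M (?f m)" for m
    using martingale_sum_second_moment[of "m\<^sup>2"] by (simp add: power_divide)
  \<comment> \<open>The second moment at most \<open>m^2 * c^2\<close> is divided by
    \<open>m^4\<close>. At \<open>m = 0\<close> both sides are 0, as division by zero yields
    0.\<close>
  have le: "expectation (?f m) \<le> c\<^sup>2 * inverse (real m ^ 2)" for m
  proof -
    have "expectation (?f m) = expectation (\<lambda>w. (?S (m\<^sup>2) w)\<^sup>2) / (real (m\<^sup>2))\<^sup>2"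
      by (simp add: power_divide)
    also have "\<dots> \<le> real (m\<^sup>2) * c\<^sup>2 / (real (m\<^sup>2))\<^sup>2"
      using martingale_sum_second_moment[of "m\<^sup>2"] by (intro divide_right_mono) auto
    also have "\<dots> = c\<^sup>2 * inverse (real m ^ 2)"
      by (simp add: field_simps power2_eq_square)
    finally show ?thesis .
  qed
  have "norm (expectation (?f m)) \<le> c\<^sup>2 * inverse (real m ^ 2)" for m
  proof -
    have "expectation (?f m) \<ge> 0"
      by (intro Bochner_Integration.integral_nonneg zero_le_power2)
    with le show ?thesis
      by (simp only: real_norm_def abs_of_nonneg)
  qed
  moreover have "summable (\<lambda>m. c\<^sup>2 * inverse (real m ^ 2))"
    by (intro summable_mult inverse_power_summable order.refl)
  ultimately have "summable (\<lambda>m. expectation (?f m))"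
    by (rule summable_comparison_test'[rotated])
  then have "AE w in M. (\<lambda>m. ?f m w) \<longlonglongrightarrow> 0"
    by (intro AE_tendsto_0_of_summable_expectation int zero_le_power2)
  then show ?thesis
  proof eventually_elim
    case (elim w)
    \<comment> \<open>The square root of a squared average is its absolute value.\<close>
    then have "(\<lambda>m. ?S (m\<^sup>2) w / real (m\<^sup>2)) \<longlonglongrightarrow> 0"
      using tendsto_rabs_zero_cancel[OF tendsto_real_sqrt[OF elim, unfolded real_sqrt_abs real_sqrt_zero]]
      by blast
    then show ?case
      by (rule averages_tendsto_0_from_squares[rotated]) (rule bound)
  qed
qed

end

end

subsection \<open>Regret of the averaging strategy\<close>

lemma is_strategy_averaging:
  fixes h :: "real ^ 'd::finite \<Rightarrow> ereal"
  assumes "regularizer h"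
  shows "is_strategy (averaging_strategy h \<eta>)"
  using choice_map_maximizes(1)[OF assms]
  by (simp add: is_strategy_def averaging_strategy_def)

lemma play_averaging_1: "play (averaging_strategy h \<eta>) u 1 = choice_map h 0"
  by (simp add: play_def averaging_strategy_def)

lemma play_averaging_Suc:
  assumes "n \<ge> 1"
  shows "play (averaging_strategy h \<eta>) u (n + 1) = choice_map h ((\<eta> / real n) *\<^sub>R (\<Sum>k=1..n. u k))"
proof -
  have "sum_list (map u [1..<Suc n]) = (\<Sum>k=1..n. u k)"
    unfolding interv_sum_list_conv_sum_set_nat set_upt atLeastLessThanSuc_atLeastAtMost ..
  then show ?thesis
    using assms by (simp add: play_def averaging_strategy_def del: upt_Suc)
qed

text \<open>After division by \<open>n\<close> only the linear term survives. The error
  \<open>e\<close> is 0 for the regret and the sum of expected minus drawn payoffs for the realized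
  regret.\<close>

lemma limsup_average_le:
  fixes r e :: "nat \<Rightarrow> real"
  assumes le: "\<And>n. n \<ge> 1 \<Longrightarrow> r n \<le> \<epsilon> * real n + b * ln (real n) + c + e n"
    and e: "(\<lambda>n. e n / real n) \<longlonglongrightarrow> 0"
  shows "limsup (\<lambda>n. ereal (1 / real n * r n)) \<le> ereal \<epsilon>"
proof -
  let ?g = "\<lambda>n. \<epsilon> + b * (ln (real n) / real n) + c / real n + e n / real n"
  have "?g \<longlonglongrightarrow> \<epsilon> + b * 0 + 0 + 0"
    by (intro tendsto_intros lim_const_over_n e)
  then have "(\<lambda>n. ereal (?g n)) \<longlonglongrightarrow> ereal \<epsilon>"
    by simp
  then have "limsup (\<lambda>n. ereal (?g n)) = ereal \<epsilon>"
    by (intro lim_imp_Limsup) simp_all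
  moreover have "1 / real n * r n \<le> ?g n" if "n \<ge> 1" for n
    using le[OF that] that by (simp add: field_simps)
  then have "limsup (\<lambda>n. ereal (1 / real n * r n)) \<le> limsup (\<lambda>n. ereal (?g n))"
    by (intro Limsup_mono) (auto simp: eventually_sequentially)
  ultimately show ?thesis by simp
qed

lemma abs_inner_simplex_le_1:
  assumes "\<forall>i. \<bar>v $ i\<bar> \<le> 1" "x \<in> prob_simplex"
  shows "\<bar>v \<bullet> x\<bar> \<le> 1"
proof -
  have "l1norm x = 1"
    using assms(2) by (simp add: l1norm_def prob_simplex_def)
  then show ?thesis
    using inner_le_l1norm[of v x] inner_le_l1norm[of "- v" x] assms(1) by simp
qed

lemma regret_slope_nonneg:
  fixes h :: "real ^ 'd::finite \<Rightarrow> ereal"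
  assumes "regularizer h" "\<eta> > 0"
  shows "0 \<le> (h_max h - h_min h) / \<eta>"
  using order_trans[OF h_min_le_regularizer regularizer_le_h_max, OF assms(1) axis_in_prob_simplex
      assms(1) axis_in_prob_simplex] assms(2)
  by simp

lemma averaging_leads_to_regret:
  fixes h :: "real ^ 'd::finite \<Rightarrow> ereal"
  assumes h: "regularizer h" and sc: "strongly_convex l1norm K h" and K: "K > 0" and \<eta>: "\<eta> > 0"
  shows "leads_to_regret (averaging_strategy h \<eta>) ((h_max h - h_min h) / \<eta>)"
  unfolding leads_to_regret_def
proof (intro conjI allI impI)
  show "0 \<le> (h_max h - h_min h) / \<eta>"
    by (rule regret_slope_nonneg[OF h \<eta>])
  fix u :: "nat \<Rightarrow> real ^ 'd"
  assume "\<forall>n\<ge>1. infnorm (u n) \<le> 1"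
  then have u: "\<bar>u n $ i\<bar> \<le> 1" if "n \<ge> 1" for n i
    using that component_le_infnorm_cart order_trans by blast
  let ?x = "play (averaging_strategy h \<eta>) u"
  let ?R = "\<lambda>n x. \<Sum>k=1..n. u k \<bullet> (x - ?x k)"
  have "(GREATEST r. r \<in> ?R n ` prob_simplex)
      \<le> (h_max h - h_min h) / \<eta> * real n + \<eta> / (2 * K) * ln (real n) + \<eta> / K + 0"
    if n: "n \<ge> 1" for n
  proof -
    have "continuous_on prob_simplex (?R n)"
      by (intro continuous_intros)
    \<comment> \<open>The maximum is attained at some \<open>z\<close>, possibly not a vertex, so
      the bound for all simplex points is used there.\<close>
    then obtain z where "z \<in> prob_simplex" "(GREATEST r. r \<in> ?R n ` prob_simplex) = ?R n z"
      using Greatest_image_compact(1)[OF compact_prob_simplex prob_simplex_nonempty] by blast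
    then show ?thesis
      using averaging_regret[OF h sc K \<eta> u play_averaging_1 play_averaging_Suc _ n] by simp
  qed
  then show "limsup (\<lambda>n. ereal (1 / real n * (GREATEST r. r \<in> ?R n ` prob_simplex)))
      \<le> ereal ((h_max h - h_min h) / \<eta>)"
    by (rule limsup_average_le) simp_all
qed

text \<open>Given the past, the drawn payoff has expectation \<open>u n \<bullet> x n\<close>, so
  the differences are centered. Both payoffs are at most 1 in absolute value, hence
  \<open>c = 2\<close>.\<close>

lemma (in prob_space) drawn_payoffs_strong_law:
  fixes u x :: "nat \<Rightarrow> real ^ 'd::finite"
  assumes u: "\<And>n i. n \<ge> 1 \<Longrightarrow> \<bar>u n $ i\<bar> \<le> 1"
    and x: "\<And>n. x n \<in> prob_simplex" and a: "draws_actions M F x a"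
  shows "AE w in M. (\<lambda>n. (\<Sum>k=1..n. u k \<bullet> x k - u k $ a k w) / real n) \<longlonglongrightarrow> 0"
proof (rule martingale_strong_law[where c = 2])
  show "filtration (space M) F" and sub: "subalgebra M (F n)" for n
    using a by (auto simp: draws_actions_def)
  fix n :: nat assume n: "n \<ge> 1"
  have a_meas: "a n \<in> measurable (F (Suc n)) (count_space UNIV)"
    using a n by (auto simp: draws_actions_def)
  show "(\<lambda>w. u n \<bullet> x n - u n $ a n w) \<in> borel_measurable (F (Suc n))"
    by (rule measurable_compose[OF a_meas]) simp
  show "\<bar>u n \<bullet> x n - u n $ a n w\<bar> \<le> 2" for w
  proof -
    have "\<bar>u n \<bullet> x n\<bar> \<le> 1"
      using u[OF n] x by (intro abs_inner_simplex_le_1) auto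
    with u[OF n, of "a n w"] show ?thesis by linarith
  qed
  interpret finite_measure_subalgebra M "F n"
    by unfold_locales (rule sub)
  have [measurable]: "a n \<in> measurable M (count_space UNIV)"
    using measurable_from_subalg[OF sub a_meas] .
  let ?I = "\<lambda>i w. indicator {i} (a n w) :: real"
  have int_I: "integrable M (?I i)" for i
    by (intro integrable_const_bound[of _ 1]) auto
  then have int_uI: "integrable M (\<lambda>w. u n $ i * ?I i w)" for i
    by simp
  \<comment> \<open>The drawn payoff is written as a finite combination of indicators, whose
    conditional expectations are prescribed by \<open>draws_actions\<close>.\<close>
  have eq: "(\<lambda>w. u n \<bullet> x n - u n $ a n w) = (\<lambda>w. u n \<bullet> x n - (\<Sum>i\<in>UNIV. u n $ i * ?I i w))"
    by (simp add: indicator_def of_bool_def if_distrib cong: if_cong)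
  have "AE w in M. real_cond_exp M (F n) (\<lambda>w. u n \<bullet> x n) w = u n \<bullet> x n"
    by (intro real_cond_exp_F_meas) auto
  moreover have "AE w in M. real_cond_exp M (F n) (\<lambda>w. u n \<bullet> x n - (\<Sum>i\<in>UNIV. u n $ i * ?I i w)) w
      = real_cond_exp M (F n) (\<lambda>w. u n \<bullet> x n) w
        - real_cond_exp M (F n) (\<lambda>w. \<Sum>i\<in>UNIV. u n $ i * ?I i w) w"
    by (intro real_cond_exp_diff integrable_const Bochner_Integration.integrable_sum int_uI)
  moreover have "AE w in M. real_cond_exp M (F n) (\<lambda>w. \<Sum>i\<in>UNIV. u n $ i * ?I i w) w
      = (\<Sum>i\<in>UNIV. real_cond_exp M (F n) (\<lambda>w. u n $ i * ?I i w) w)"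
    by (intro real_cond_exp_sum int_uI)
  moreover have "AE w in M. \<forall>i\<in>UNIV. real_cond_exp M (F n) (\<lambda>w. u n $ i * ?I i w) w
      = u n $ i * real_cond_exp M (F n) (?I i) w"
    by (intro AE_finite_allI real_cond_exp_cmult int_I) simp
  moreover have "AE w in M. \<forall>i\<in>UNIV. real_cond_exp M (F n) (?I i) w = x n $ i"
    using a n by (intro AE_finite_allI) (auto simp: draws_actions_def)
  ultimately have "AE w in M. real_cond_exp M (F n)
      (\<lambda>w. u n \<bullet> x n - (\<Sum>i\<in>UNIV. u n $ i * ?I i w)) w = 0"
    by eventually_elim (simp add: inner_vec_def)
  then show "AE w in M. real_cond_exp M (F n) (\<lambda>w. u n \<bullet> x n - u n $ a n w) w = 0"
    unfolding eq .
qed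

text \<open>The realized regret against \<open>i\<close> is the regret against the vertex
  \<open>axis i 1\<close> plus the sum of expected minus drawn payoffs. The latter is independent of
  \<open>i\<close>, so it passes through the maximum, and its average tends to 0 almost
  surely.\<close>

lemma averaging_leads_to_realized_regret:
  fixes h :: "real ^ 'd::finite \<Rightarrow> ereal"
  assumes h: "regularizer h" and sc: "strongly_convex l1norm K h" and K: "K > 0" and \<eta>: "\<eta> > 0"
    and M: "prob_space (M :: 'a measure)"
  shows "leads_to_realized_regret M (averaging_strategy h \<eta>) ((h_max h - h_min h) / \<eta>)"
  unfolding leads_to_realized_regret_def
proof (intro conjI allI impI)
  interpret prob_space M by (rule M)
  show "0 \<le> (h_max h - h_min h) / \<eta>"
    by (rule regret_slope_nonneg[OF h \<eta>])
  fix u :: "nat \<Rightarrow> real ^ 'd" and F and a :: "nat \<Rightarrow> 'a \<Rightarrow> 'd"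
  let ?x = "play (averaging_strategy h \<eta>) u"
  assume "\<forall>n\<ge>1. infnorm (u n) \<le> 1" and a: "draws_actions M F ?x a"
  then have u: "\<bar>u n $ i\<bar> \<le> 1" if "n \<ge> 1" for n i
    using that component_le_infnorm_cart order_trans by blast
  have "?x n \<in> prob_simplex" for n
    using is_strategy_averaging[OF h] by (simp add: play_def is_strategy_def)
  then have "AE w in M. (\<lambda>n. (\<Sum>k=1..n. u k \<bullet> ?x k - u k $ a k w) / real n) \<longlonglongrightarrow> 0"
    using u a by (intro drawn_payoffs_strong_law) auto
  then show "AE w in M. limsup (\<lambda>n. ereal (1 / real n * (MAX i. \<Sum>k=1..n. u k $ i - u k $ a k w)))
      \<le> ereal ((h_max h - h_min h) / \<eta>)"
  proof eventually_elim
    case (elim w)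
    have "(MAX i. \<Sum>k=1..n. u k $ i - u k $ a k w)
        \<le> (h_max h - h_min h) / \<eta> * real n + \<eta> / (2 * K) * ln (real n) + \<eta> / K
          + (\<Sum>k=1..n. u k \<bullet> ?x k - u k $ a k w)" if n: "n \<ge> 1" for n
    proof -
      have "(\<Sum>k=1..n. u k $ i - u k $ a k w)
          = (\<Sum>k=1..n. u k \<bullet> (axis i 1 - ?x k)) + (\<Sum>k=1..n. u k \<bullet> ?x k - u k $ a k w)" for i
        by (simp add: sum.distrib[symmetric] inner_diff_right inner_axis)
      then have "(\<Sum>k=1..n. u k $ i - u k $ a k w)
          \<le> (h_max h - h_min h) / \<eta> * real n + \<eta> / (2 * K) * ln (real n) + \<eta> / K
            + (\<Sum>k=1..n. u k \<bullet> ?x k - u k $ a k w)" for i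
        using averaging_regret[where z = "axis i 1",
            OF h sc K \<eta> u play_averaging_1 play_averaging_Suc axis_in_prob_simplex n] by simp
      then show ?thesis
        by (intro Max.boundedI) auto
    qed
    then show ?case
      using elim by (rule limsup_average_le)
  qed
qed

theorem proposition6p1:
  fixes h :: "real ^ 'd \<Rightarrow> ereal" and K \<eta> :: real
  assumes "regularizer h"
    and "K > 0"
    and "strongly_convex l1norm K h"
    and "\<eta> > 0"
  shows "is_strategy (averaging_strategy h \<eta>)
    \<and> (\<forall>u x. (\<forall>n\<ge>1. \<forall>i. u n $ i \<in> {-1..1}) \<longrightarrow>
          x 1 = choice_map h 0 \<longrightarrow>
          (\<forall>n\<ge>1. x (n + 1) = choice_map h ((\<eta> / real n) *\<^sub>R (\<Sum>k=1..n. u k))) \<longrightarrow>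
          (\<forall>n\<ge>1. (MAX a. \<Sum>k=1..n. u k \<bullet> (axis a 1 - x k))
              \<le> (h_max h - h_min h) / \<eta> * real n + \<eta> * ln (real n) / (2 * K) + \<eta> / K))
    \<and> leads_to_regret (averaging_strategy h \<eta>) ((h_max h - h_min h) / \<eta>)
    \<and> (\<forall>M :: 'w measure. prob_space M \<longrightarrow>
          leads_to_realized_regret M (averaging_strategy h \<eta>) ((h_max h - h_min h) / \<eta>))"
proof (intro conjI allI impI)
  note h = assms(1) and K = assms(2) and sc = assms(3) and \<eta> = assms(4)
  show "is_strategy (averaging_strategy h \<eta>)"
    by (rule is_strategy_averaging[OF h])
  show "leads_to_regret (averaging_strategy h \<eta>) ((h_max h - h_min h) / \<eta>)"
    by (rule averaging_leads_to_regret[OF h sc K \<eta>])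
  show "leads_to_realized_regret M (averaging_strategy h \<eta>) ((h_max h - h_min h) / \<eta>)"
    if "prob_space M" for M :: "'w measure"
    by (rule averaging_leads_to_realized_regret[OF h sc K \<eta> that])
  fix u x :: "nat \<Rightarrow> real ^ 'd" and n :: nat
  assume u: "\<forall>n\<ge>1. \<forall>i. u n $ i \<in> {-1..1}" and x1: "x 1 = choice_map h 0"
    and x: "\<forall>n\<ge>1. x (n + 1) = choice_map h ((\<eta> / real n) *\<^sub>R (\<Sum>k=1..n. u k))"
    and n: "n \<ge> 1"
  have "\<bar>u k $ i\<bar> \<le> 1" if "k \<ge> 1" for k i
    using u that by (auto simp: abs_le_iff minus_le_iff)
  \<comment> \<open>Actions are vertices of the simplex, so the bound holds for each of them and
    passes to the finite maximum.\<close>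
  then have "(\<Sum>k=1..n. u k \<bullet> (axis i 1 - x k))
      \<le> (h_max h - h_min h) / \<eta> * real n + \<eta> * ln (real n) / (2 * K) + \<eta> / K" for i
    using x by (intro averaging_regret h sc K \<eta> x1 axis_in_prob_simplex n) auto
  then show "(MAX a. \<Sum>k=1..n. u k \<bullet> (axis a 1 - x k))
      \<le> (h_max h - h_min h) / \<eta> * real n + \<eta> * ln (real n) / (2 * K) + \<eta> / K"
    by (intro Max.boundedI) auto
qed

end
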